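(* If $G$ is a graph of order $n\ge 4$ having exactly one vertex of degree $n-1$, then for any integer $t\ge 2$, $$\gamma_R(S(G,t))=n^{t-2}(2n-1).$$
   Context: Graphs are finite and simple. For a graph $G=(V,E)$ of order $n\ge 2$ and an integer $t\ge1$, let $V^t$ be the set of words of length $t$ over the alphabet $V$; concatenation of words is written by juxtaposition and $x^{k}$ denotes the word $xx\cdots x$ of length $k$. The generalized Sierpiński graph $S(G,t)$ is the graph with vertex set $V^t$ and edge set $\{\{w x y^{r-1}, w y x^{r-1}\}: \{x,y\}\in E,\ r\in\{1,\dots,t\},\ w\in V^{t-r}\}$ (so $S(G,1)=G$). A Roman dominating function on a graph $H$ with vertex set $W$ is a map $f:W\to\{0,1,2\}$ such that every vertex $v$ with $f(v)=0$ has a neighbor $u$ with $f(u)=2$. Its weight is $\sum_{u\in W}f(u)$. The Roman domination number $\gamma_R(H)$ is the minimum weight of a Roman dominating function on $H$. *)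

theory Defs
  imports Main
begin

record 'a ugraph =
  verts :: "'a set"
  edges :: "'a set set"

definition simple_graph :: "'a ugraph \<Rightarrow> bool" where
  "simple_graph G \<longleftrightarrow>
     finite (verts G) \<and> (\<forall>e\<in>edges G. e \<subseteq> verts G \<and> card e = 2)"

definition order :: "'a ugraph \<Rightarrow> nat" where
  "order G = card (verts G)"

definition neighbors :: "'a ugraph \<Rightarrow> 'a \<Rightarrow> 'a set" where
  "neighbors G v = {u \<in> verts G. {u, v} \<in> edges G}"

definition degree :: "'a ugraph \<Rightarrow> 'a \<Rightarrow> nat" where
  "degree G v = card (neighbors G v)"

definition words :: "'a set \<Rightarrow> nat \<Rightarrow> 'a list set" where
  "words A k = {w. set w \<subseteq> A \<and> length w = k}"

definition sierpinski :: "'a ugraph \<Rightarrow> nat \<Rightarrow> 'a list ugraph" where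
  "sierpinski G t =
     \<lparr> verts = words (verts G) t,
       edges = {{w @ [x] @ replicate (r - 1) y, w @ [y] @ replicate (r - 1) x} | w x y r.
                  {x, y} \<in> edges G \<and> r \<in> {1..t} \<and> w \<in> words (verts G) (t - r)} \<rparr>"

text \<open>Values of \<open>f\<close> outside the vertex set are irrelevant: neither the domination condition
  nor the weight looks at them.\<close>

definition roman_dominating :: "'a ugraph \<Rightarrow> ('a \<Rightarrow> nat) \<Rightarrow> bool" where
  "roman_dominating H f \<longleftrightarrow>
     (\<forall>v\<in>verts H. f v \<in> {0, 1, 2}) \<and>
     (\<forall>v\<in>verts H. f v = 0 \<longrightarrow> (\<exists>u\<in>neighbors H v. f u = 2))"

definition weight :: "'a ugraph \<Rightarrow> ('a \<Rightarrow> nat) \<Rightarrow> nat" where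
  "weight H f = (\<Sum>u\<in>verts H. f u)"

definition roman_domination_number :: "'a ugraph \<Rightarrow> nat" where
  "roman_domination_number H = (LEAST k. \<exists>f. roman_dominating H f \<and> weight H f = k)"

lemma roman_domination_number_attained:
  "\<exists>f. roman_dominating H f \<and> weight H f = roman_domination_number H"
proof -
  have "roman_dominating H (\<lambda>_. 1)"
    by (simp add: roman_dominating_def)
  then have "\<exists>k f. roman_dominating H f \<and> weight H f = k"
    by blast
  then show ?thesis
    unfolding roman_domination_number_def by (rule LeastI_ex)
qed

lemma simple_graph_sierpinski:
  assumes "simple_graph G"
  shows "simple_graph (sierpinski G t)"
proof -
  have "finite (words (verts G) t)"
    using assms finite_lists_length_eq[of "verts G" t]
    by (simp add: simple_graph_def words_def)
  moreover have "e \<subseteq> words (verts G) t \<and> card e = 2" if "e \<in> edges (sierpinski G t)" for e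
  proof -
    from that obtain w x y r where e: "e = {w @ [x] @ replicate (r - 1) y, w @ [y] @ replicate (r - 1) x}"
      and xy: "{x, y} \<in> edges G" and r: "r \<in> {1..t}" and w: "w \<in> words (verts G) (t - r)"
      by (auto simp: sierpinski_def)
    have "{x, y} \<subseteq> verts G" "card {x, y} = 2"
      using assms xy by (auto simp: simple_graph_def)
    then have "x \<in> verts G" "y \<in> verts G" "x \<noteq> y"
      by auto
    then show ?thesis
      using e r w by (auto simp: words_def)
  qed
  ultimately show ?thesis
    by (simp add: simple_graph_def sierpinski_def)
qed

end

theory Submission
  imports Defs
begin

text \<open>
  Let \<open>c\<close> be the universal vertex and split the words of length \<open>t = m + 2\<close> into blocks
  \<open>w z x\<close> with \<open>w\<close> of length \<open>m\<close>, each block consisting of \<open>n\<close> copies \<open>w z _\<close> of \<open>G\<close>.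

  Upper bound: put 2 on every \<open>w z c\<close> with \<open>z \<noteq> c\<close> and 1 on \<open>w c c\<close>; the vertices \<open>w c z\<close>
  are dominated from \<open>w z c\<close>.

  Lower bound: inside a block, a copy \<open>z \<noteq> c\<close> has positive weight, and if its weight is 1 then
  \<open>f (w c z) = 2\<close>, so that copy \<open>c\<close> makes up for all these deficits. Moreover \<open>f (w z z) = 2\<close>
  forces weight at least 3 on copy \<open>z \<noteq> c\<close>. Hence a block weighs at least \<open>2 n - 1\<close> plus the
  number of such \<open>z\<close>, except for a loss of 1 when copy \<open>c\<close> has weight 0. In the latter case
  \<open>w c c\<close> is dominated by a vertex \<open>w' z z\<close> with \<open>z \<noteq> c\<close> in another block, and as every vertex
  has at most one neighbour outside its copy, these losses are matched injectively with the gains.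
\<close>

section \<open>Weight of a single block\<close>

text \<open>Here \<open>g z x\<close> stands for the value at \<open>w z x\<close>. The premise
  \<open>dom\<close> lists the dominators within the block; it omits \<open>z = x\<close>, as
  \<open>w z z\<close> may be dominated from another block. For \<open>x\<close> not adjacent to
  \<open>z\<close> there is no edge between \<open>w z x\<close> and \<open>w x z\<close>, so
  \<open>w z x\<close> has to be served inside copy \<open>z\<close>, which forces weight
  there.\<close>

lemma block_weight_ge:
  fixes g :: "'a \<Rightarrow> 'a \<Rightarrow> nat"
  assumes fin: "finite (verts G)" and c: "c \<in> verts G"
    and univ: "\<And>z. z \<in> verts G \<Longrightarrow> z \<noteq> c \<Longrightarrow> c \<in> neighbors G z"
    and nonadj: "\<And>z. z \<in> verts G \<Longrightarrow> z \<noteq> c \<Longrightarrow>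
                  \<exists>x\<in>verts G. x \<noteq> z \<and> x \<notin> neighbors G z \<and> z \<notin> neighbors G x"
    and dom: "\<And>z x. z \<in> verts G \<Longrightarrow> x \<in> verts G \<Longrightarrow> z \<noteq> x \<Longrightarrow> g z x = 0 \<Longrightarrow>
                (\<exists>y\<in>neighbors G x. g z y = 2) \<or> z \<in> neighbors G x \<and> g x z = 2"
  shows "2 * card (verts G) - 1 + card {z \<in> verts G. z \<noteq> c \<and> g z z = 2}
           \<le> (\<Sum>z\<in>verts G. \<Sum>x\<in>verts G. g z x) + (if (\<Sum>x\<in>verts G. g c x) = 0 then 1 else 0)"
proof -
  define V where "V = verts G"
  define k where "k z = (\<Sum>x\<in>V. g z x)" for z
  define D where "D = {z \<in> V - {c}. k z = 1}"
  define Z where "Z = {z \<in> V - {c}. g z z = 2}"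
  have finV: "finite V" and cV: "c \<in> V"
    using fin c by (simp_all add: V_def)
  have nb: "neighbors G x \<subseteq> V" for x
    by (auto simp: neighbors_def V_def)
  have ge: "g z x \<le> k z" if "x \<in> V" for z x
    unfolding k_def using finV that by (intro member_le_sum) auto
  have ge2: "g z x + g z y \<le> k z" if "x \<in> V" "y \<in> V" "x \<noteq> y" for z x y
    using sum_mono2[OF finV, of "{x, y}" "g z"] that by (simp add: k_def)
  have heavy: "1 \<le> k z \<and> (k z = 1 \<longrightarrow> g c z = 2) \<and> (g z z = 2 \<longrightarrow> 3 \<le> k z)"
    if z: "z \<in> V - {c}" for z
  proof -
    obtain x where x: "x \<in> V" "x \<noteq> z" "x \<notin> neighbors G z" "z \<notin> neighbors G x"
      using nonadj[of z] z by (auto simp: V_def)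
    have x_dom: "g z x \<noteq> 0 \<or> (\<exists>y\<in>neighbors G x. g z y = 2)"
      using dom[of z x] x z by (auto simp: V_def)
    have "x \<noteq> c"
      using univ[of z] z x by (auto simp: V_def)
    have pos: "1 \<le> k z"
      using x_dom ge[of _ z] nb x(1) by fastforce
    have one: "g c z = 2" if k1: "k z = 1"
    proof -
      have no2: "\<not> (\<exists>y\<in>V. g z y = 2)"
        using ge[of _ z] k1 by fastforce
      then have "g z x \<noteq> 0"
        using x_dom nb by blast
      \<comment> \<open>The single unit sits on \<open>x\<close>, so \<open>w z c\<close> has value
        0; with no 2 in copy \<open>z\<close>, only \<open>w c z\<close> can dominate it.\<close>
      then have "g z c = 0"
        using ge2[OF x(1) cV \<open>x \<noteq> c\<close>, of z] k1 by simp
      then show ?thesis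
        using dom[of z c] z cV no2 nb[of c] by (auto simp: V_def)
    qed
    \<comment> \<open>Being no neighbour of \<open>z\<close>, the vertex \<open>x\<close> is not
      served by the 2 on \<open>z\<close>: it has positive value itself or needs a second 2.\<close>
    have three: "3 \<le> k z" if zz: "g z z = 2"
    proof (cases "g z x = 0")
      case True
      then obtain y where y: "y \<in> neighbors G x" "g z y = 2"
        using x_dom by blast
      then have "y \<noteq> z" "y \<in> V"
        using x nb by auto
      then show ?thesis
        using ge2[of z y z] z zz y by auto
    next
      case False
      then show ?thesis
        using ge2[of z x z] z zz x by auto
    qed
    show ?thesis
      using pos one three by blast
  qed
  have "2 * card D = (\<Sum>z\<in>D. g c z)"
    using heavy by (simp add: D_def)
  also have "\<dots> \<le> k c"
    unfolding k_def using finV by (intro sum_mono2) (auto simp: D_def)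
  finally have kc: "2 * card D \<le> k c" .
  have "(\<Sum>z\<in>V - {c}. 2 + (if z \<in> Z then 1 else 0))
          \<le> (\<Sum>z\<in>V - {c}. k z + (if z \<in> D then 1 else 0))"
  proof (rule sum_mono)
    fix z assume "z \<in> V - {c}"
    then show "2 + (if z \<in> Z then 1 else 0) \<le> k z + (if z \<in> D then 1 else 0)"
      using heavy[of z] by (auto simp: D_def Z_def)
  qed
  moreover have "(V - {c}) \<inter> Z = Z" "(V - {c}) \<inter> D = D"
    by (auto simp: D_def Z_def)
  then have "(\<Sum>z\<in>V - {c}. if z \<in> Z then 1 else 0) = card Z"
      "(\<Sum>z\<in>V - {c}. if z \<in> D then 1 else 0) = card D"
    using finV by (simp_all add: sum.If_cases)
  moreover have "card (V - {c}) = card V - 1"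
    using finV cV by simp
  ultimately have "2 * (card V - 1) + card Z \<le> (\<Sum>z\<in>V - {c}. k z) + card D"
    unfolding sum.distrib sum_constant by simp
  moreover have "(\<Sum>z\<in>V. k z) = k c + (\<Sum>z\<in>V - {c}. k z)"
    using finV cV by (rule sum.remove)
  moreover have "0 < card V"
    using finV cV card_gt_0_iff by blast
  \<comment> \<open>By \<open>kc\<close>, the surplus \<open>k c - card D\<close> is at least 1
    unless \<open>k c = 0\<close>; this is the unit separating \<open>2 * (card V - 1)\<close> from
    \<open>2 * card V - 1\<close>.\<close>
  ultimately have "2 * card V - 1 + card Z \<le> (\<Sum>z\<in>V. k z) + (if k c = 0 then 1 else 0)"
    using kc by auto
  moreover have "Z = {z \<in> verts G. z \<noteq> c \<and> g z z = 2}"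
    by (auto simp: Z_def V_def)
  ultimately show ?thesis
    by (simp add: k_def V_def)
qed

section \<open>Words and adjacency in Sierpinski graphs\<close>

lemma finite_words: "finite A \<Longrightarrow> finite (words A k)"
  using finite_lists_length_eq[of A k] by (simp add: words_def)

lemma card_words: "finite A \<Longrightarrow> card (words A k) = card A ^ k"
  using card_lists_length_eq[of A k] by (simp add: words_def)

text \<open>Letters are split off at the end because copies and blocks are given by common
  prefixes.\<close>

lemma words_Suc: "words A (Suc k) = (\<lambda>(w, x). w @ [x]) ` (words A k \<times> A)"
proof -
  have "u \<in> (\<lambda>(w, x). w @ [x]) ` (words A k \<times> A)" if "u \<in> words A (Suc k)" for u
    using that by (cases u rule: rev_cases) (auto simp: words_def)
  then show ?thesis
    by (auto simp: words_def)
qed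

lemma sum_words_Suc:
  "sum f (words A (Suc k)) = (\<Sum>w\<in>words A k. \<Sum>x\<in>A. f (w @ [x]))"
proof -
  have "inj_on (\<lambda>(w, x). w @ [x]) (words A k \<times> A)"
    by (auto simp: inj_on_def)
  then show ?thesis
    unfolding words_Suc by (simp add: sum.reindex sum.cartesian_product case_prod_unfold)
qed

lemma sum_words_Suc_Suc:
  "sum f (words A (Suc (Suc k))) = (\<Sum>w\<in>words A k. \<Sum>z\<in>A. \<Sum>x\<in>A. f (w @ [z, x]))"
  by (simp add: sum_words_Suc)

lemma verts_sierpinski [simp]: "verts (sierpinski G t) = words (verts G) t"
  by (simp add: sierpinski_def)

lemma edge_distinct:
  assumes "simple_graph G" "{x, y} \<in> edges G"
  shows "x \<in> verts G" "y \<in> verts G" "x \<noteq> y"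
proof -
  have "{x, y} \<subseteq> verts G" "card {x, y} = 2"
    using assms by (auto simp: simple_graph_def)
  then show "x \<in> verts G" "y \<in> verts G" "x \<noteq> y"
    by auto
qed

text \<open>The substitution \<open>r = Suc j\<close>, \<open>t = k + Suc j\<close> removes the
  truncated subtractions of the definition.\<close>

lemma sierpinski_edgeI:
  assumes "{x, y} \<in> edges G" "w \<in> words (verts G) k"
  shows "{w @ [x] @ replicate j y, w @ [y] @ replicate j x} \<in> edges (sierpinski G (k + Suc j))"
proof -
  have "\<exists>v a b r. {w @ [x] @ replicate j y, w @ [y] @ replicate j x}
            = {v @ [a] @ replicate (r - 1) b, v @ [b] @ replicate (r - 1) a}
          \<and> {a, b} \<in> edges G \<and> r \<in> {1..k + Suc j} \<and> v \<in> words (verts G) (k + Suc j - r)"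
    using assms by (intro exI[of _ w] exI[of _ x] exI[of _ y] exI[of _ "Suc j"]) simp
  then show ?thesis
    by (simp add: sierpinski_def)
qed

text \<open>The case \<open>r = 1\<close> changes only the last letter and stays in the copy; for
  \<open>r > 1\<close> the edge exchanges \<open>a\<close> with the run of \<open>x\<close> that
  follows it.\<close>

lemma sierpinski_neighborE:
  assumes G: "simple_graph G" and u: "u \<in> neighbors (sierpinski G t) (w @ [x])"
  obtains (inner) y where "y \<in> neighbors G x" "u = w @ [y]"
    | (outer) p a k where "a \<in> neighbors G x" "w = p @ [a] @ replicate k x"
        "u = p @ [x] @ replicate (Suc k) a"
proof -
  have "{u, w @ [x]} \<in> edges (sierpinski G t)"
    using u by (simp add: neighbors_def)
  then obtain p a' b' r where e: "{a', b'} \<in> edges G"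
      "{u, w @ [x]} = {p @ [a'] @ replicate (r - 1) b', p @ [b'] @ replicate (r - 1) a'}"
    unfolding sierpinski_def ugraph.simps mem_Collect_eq by blast
  \<comment> \<open>Edges are unordered, so the endpoints are renamed to make \<open>w @ [x]\<close>
    the first one.\<close>
  obtain a b where ab: "{a, b} \<in> edges G"
      "w @ [x] = p @ [a] @ replicate (r - 1) b" "u = p @ [b] @ replicate (r - 1) a"
    using e that[of a' b'] that[of b' a'] by (auto simp only: doubleton_eq_iff insert_commute)
  note V = edge_distinct[OF G ab(1)]
  show thesis
  proof (cases "r - 1")
    case 0
    then show thesis
      using ab V inner[of b] by (simp add: neighbors_def insert_commute)
  next
    case (Suc k)
    then have "w @ [x] = (p @ [a] @ replicate k b) @ [b]"
      using ab(2) by (simp add: replicate_append_same)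
    then have "b = x" "w = p @ [a] @ replicate k x"
      by auto
    then show thesis
      using ab V outer[of a p k] Suc by (simp add: neighbors_def)
  qed
qed

text \<open>The final run of \<open>a\<close> is stopped by \<open>c\<close>, so the word determines
  its letter, its length and the prefix. This makes the outside neighbour unique.\<close>

lemma append_replicate_eqD:
  assumes "p @ [c] @ replicate (Suc k) a = q @ [c] @ replicate (Suc l) b" "a \<noteq> c" "b \<noteq> c"
  shows "p = q" "k = l" "a = b"
proof -
  have rev_eq: "replicate (Suc k) a @ c # rev p = replicate (Suc l) b @ c # rev q"
    using arg_cong[OF assms(1), of rev]
    by (simp only: rev_append rev_replicate rev.simps append_Nil append_Cons append_assoc)
  then show "a = b"
    by simp
  \<comment> \<open>After reversal, \<open>takeWhile\<close> extracts exactly this run.\<close>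
  have *: "takeWhile (\<lambda>x. x = a) (replicate j a @ c # s) = replicate j a" for j s
    using assms(2) by (induction j) auto
  have "replicate (Suc k) a = replicate (Suc l) a"
    using arg_cong[OF rev_eq, of "takeWhile (\<lambda>x. x = a)"]
    unfolding \<open>a = b\<close>[symmetric] * .
  then show "k = l"
    by (metis Suc_inject length_replicate)
  then show "p = q"
    using rev_eq \<open>a = b\<close> by simp
qed

text \<open>Without loops, degree \<open>order G - 1\<close> means adjacency to all other vertices;
  uniqueness then gives every \<open>z\<close> other than \<open>c\<close> a non-neighbour.\<close>

lemma ex1_universal_vertexE:
  assumes G: "simple_graph G"
    and ex1: "\<exists>!v. v \<in> verts G \<and> degree G v = order G - 1"
  obtains c where "c \<in> verts G" "\<And>z. z \<in> verts G \<Longrightarrow> z \<noteq> c \<Longrightarrow> {c, z} \<in> edges G"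
    "\<And>z. z \<in> verts G \<Longrightarrow> z \<noteq> c \<Longrightarrow> \<exists>x\<in>verts G. x \<noteq> z \<and> {x, z} \<notin> edges G"
proof -
  have fin: "finite (verts G)"
    using G by (simp add: simple_graph_def)
  have sub: "neighbors G v \<subseteq> verts G - {v}" for v
    using edge_distinct(3)[OF G, of v v] by (auto simp: neighbors_def)
  have full: "degree G v = order G - 1 \<longleftrightarrow> neighbors G v = verts G - {v}"
    if "v \<in> verts G" for v
  proof -
    have "card (verts G - {v}) = order G - 1"
      using fin that by (simp add: order_def)
    then show ?thesis
      using card_subset_eq[OF _ sub[of v]] fin unfolding degree_def by fastforce
  qed
  obtain c where c: "c \<in> verts G" "degree G c = order G - 1"
    and uniq: "\<And>v. v \<in> verts G \<Longrightarrow> degree G v = order G - 1 \<Longrightarrow> v = c"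
    using ex1 by blast
  show thesis
  proof (rule that)
    show "c \<in> verts G" by (fact c)
    show "{c, z} \<in> edges G" if "z \<in> verts G" "z \<noteq> c" for z
    proof -
      have "z \<in> neighbors G c"
        using that full[of c] c by simp
      then show ?thesis
        by (simp add: neighbors_def insert_commute)
    qed
    show "\<exists>x\<in>verts G. x \<noteq> z \<and> {x, z} \<notin> edges G" if z: "z \<in> verts G" "z \<noteq> c" for z
    proof -
      have "neighbors G z \<noteq> verts G - {z}"
        using full[of z] uniq[of z] z by auto
      then obtain x where "x \<in> verts G" "x \<noteq> z" "x \<notin> neighbors G z"
        using sub[of z] by blast
      then show ?thesis
        by (auto simp: neighbors_def)
    qed
  qed
qed

section \<open>Upper bound\<close>

lemma roman_dominating_sierpinski_universal:
  assumes G: "simple_graph G" and c: "c \<in> verts G"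
    and univ: "\<And>z. z \<in> verts G \<Longrightarrow> z \<noteq> c \<Longrightarrow> {c, z} \<in> edges G"
  defines "f \<equiv> \<lambda>u. if last u \<noteq> c then 0 else if last (butlast u) = c then 1 else (2::nat)"
  shows "roman_dominating (sierpinski G (Suc (Suc m))) f"
    and "weight (sierpinski G (Suc (Suc m))) f = order G ^ m * (2 * order G - 1)"
proof -
  have fin: "finite (verts G)"
    using G by (simp add: simple_graph_def)
  have f: "f (w @ [z, x]) = (if x \<noteq> c then 0 else if z = c then 1 else 2)" for w z x
    by (simp add: f_def butlast_append)
  have "\<exists>u\<in>neighbors (sierpinski G (Suc (Suc m))) v. f u = 2"
    if v: "v \<in> words (verts G) (Suc (Suc m))" and "f v = 0" for v
  proof -
    obtain w z x where vw: "v = w @ [z, x]" and w: "w \<in> words (verts G) m"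
      and zx: "z \<in> verts G" "x \<in> verts G"
      using v by (auto simp: words_Suc)
    have "x \<noteq> c"
      using \<open>f v = 0\<close> by (auto simp: vw f split: if_splits)
    then have cx: "{c, x} \<in> edges G"
      using univ zx by blast
    show ?thesis
    proof (cases "z = c")
      case True
      \<comment> \<open>Copy \<open>c\<close> contains no 2, so the dominator comes from copy
        \<open>x\<close>, along an edge with \<open>r = 2\<close>.\<close>
      have "{w @ [x, c], w @ [c, x]} \<in> edges (sierpinski G (Suc (Suc m)))"
        using sierpinski_edgeI[of x c G w m 1] cx w by (simp add: insert_commute)
      then show ?thesis
        using \<open>x \<noteq> c\<close> True zx c w
        by (intro bexI[of _ "w @ [x, c]"]) (auto simp: neighbors_def vw f words_def)
    next
      case False
      have "w @ [z] \<in> words (verts G) (Suc m)"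
        using w zx by (simp add: words_def)
      then have "{w @ [z, c], w @ [z, x]} \<in> edges (sierpinski G (Suc (Suc m)))"
        using sierpinski_edgeI[OF cx, of "w @ [z]" "Suc m" 0] by simp
      then show ?thesis
        using False zx c w
        by (intro bexI[of _ "w @ [z, c]"]) (auto simp: neighbors_def vw f words_def)
    qed
  qed
  then show "roman_dominating (sierpinski G (Suc (Suc m))) f"
    by (auto simp: roman_dominating_def f_def)
  have "(\<Sum>x\<in>verts G. f (w @ [z, x])) = (if z = c then 1 else 2)" for w z
    using fin c by (simp add: f sum.remove[OF fin c])
  moreover have "(\<Sum>z\<in>verts G. if z = c then 1 else 2) = 2 * order G - 1"
  proof -
    have "0 < card (verts G)"
      using fin c card_gt_0_iff by blast
    then show ?thesis
      using fin c by (simp add: sum.remove[OF fin c] order_def)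
  qed
  ultimately show "weight (sierpinski G (Suc (Suc m))) f = order G ^ m * (2 * order G - 1)"
    using fin by (simp add: weight_def sum_words_Suc_Suc card_words order_def)
qed

section \<open>Lower bound\<close>

lemma weight_sierpinski_ge:
  assumes G: "simple_graph G" and c: "c \<in> verts G"
    and univ: "\<And>z. z \<in> verts G \<Longrightarrow> z \<noteq> c \<Longrightarrow> {c, z} \<in> edges G"
    and nonadj: "\<And>z. z \<in> verts G \<Longrightarrow> z \<noteq> c \<Longrightarrow> \<exists>x\<in>verts G. x \<noteq> z \<and> {x, z} \<notin> edges G"
    and f: "roman_dominating (sierpinski G (Suc (Suc m))) f"
  shows "order G ^ m * (2 * order G - 1) \<le> weight (sierpinski G (Suc (Suc m))) f"
proof -
  let ?V = "verts G" and ?S = "sierpinski G (Suc (Suc m))"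
  define W where "W = words ?V m"
  have fin: "finite ?V"
    using G by (simp add: simple_graph_def)
  have finW: "finite W"
    using fin by (simp add: W_def finite_words)
  define Z where "Z w = {z \<in> ?V. z \<noteq> c \<and> f (w @ [z, z]) = 2}" for w
  define Loss where "Loss = {w \<in> W. (\<Sum>x\<in>?V. f (w @ [c, x])) = 0}"
  have dom: "\<exists>u\<in>neighbors ?S (w @ [z, x]). f u = 2"
    if "w \<in> W" "z \<in> ?V" "x \<in> ?V" "f (w @ [z, x]) = 0" for w z x
    using f that by (auto simp: roman_dominating_def W_def words_def)

  have block: "2 * order G - 1 + card (Z w)
      \<le> (\<Sum>z\<in>?V. \<Sum>x\<in>?V. f (w @ [z, x])) + (if w \<in> Loss then 1 else 0)"
    if w: "w \<in> W" for w
  proof -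
    have "(\<exists>y\<in>neighbors G x. f (w @ [z, y]) = 2) \<or> z \<in> neighbors G x \<and> f (w @ [x, z]) = 2"
      if zx: "z \<in> ?V" "x \<in> ?V" "z \<noteq> x" "f (w @ [z, x]) = 0" for z x
    proof -
      obtain u where u: "u \<in> neighbors ?S ((w @ [z]) @ [x])" "f u = 2"
        using dom[OF w] zx by auto
      from G u(1) show ?thesis
      proof (cases rule: sierpinski_neighborE)
        case (inner y)
        then show ?thesis using u by auto
      next
        case (outer p a k)
        \<comment> \<open>As \<open>z\<close> differs from \<open>x\<close>, the final run of
          \<open>x\<close> has length 1, so the outer edge leads to \<open>w x z\<close> in the same
          block.\<close>
        have "k = 0"
        proof (rule ccontr)
          assume "k \<noteq> 0"
          then obtain j where "k = Suc j"
            using not0_implies_Suc by blast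
          then have "w @ [z] = (p @ [a] @ replicate j x) @ [x]"
            using outer(2) by (simp add: replicate_append_same)
          then show False
            using \<open>z \<noteq> x\<close> by simp
        qed
        then show ?thesis using outer u by auto
      qed
    qed
    then show ?thesis
      using block_weight_ge[OF fin c, of "\<lambda>z x. f (w @ [z, x])"] univ nonadj c w
      by (fastforce simp: neighbors_def Z_def Loss_def order_def insert_commute)
  qed

  \<comment> \<open>A losing block \<open>w = p a c^k\<close> is assigned the pair
    \<open>(p c a^k, a)\<close>, which names the dominator of \<open>w c c\<close>; \<open>p\<close>
    and \<open>k\<close> are recorded so that \<open>w\<close> can be recovered.\<close>
  have "\<exists>q. q \<in> Sigma W Z \<and> (\<exists>p k. w = p @ [snd q] @ replicate k c
               \<and> fst q @ [snd q, snd q] = p @ [c] @ replicate (Suc (Suc k)) (snd q))"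
    if "w \<in> Loss" for w
  proof -
    have w: "w \<in> W" and zero: "f (w @ [c, x]) = 0" if "x \<in> ?V" for x
      using \<open>w \<in> Loss\<close> fin that by (auto simp: Loss_def)
    then obtain u where u: "u \<in> neighbors ?S ((w @ [c]) @ [c])" "f u = 2"
      using dom[of w c c] c by auto
    from G u(1) show ?thesis
    proof (cases rule: sierpinski_neighborE)
      case (inner y)
      then show ?thesis using u zero[of y] by (auto simp: neighbors_def)
    next
      case (outer p a k)
      have a: "a \<in> ?V" "a \<noteq> c"
        using outer(1) edge_distinct[OF G, of a c] by (auto simp: neighbors_def)
      \<comment> \<open>For \<open>k = 0\<close> the last letter would give
        \<open>a = c\<close>.\<close>
      obtain j where k: "k = Suc j"
        using outer(2) a by (cases k) auto
      have "w @ [c] = (p @ [a] @ replicate j c) @ [c]"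
        using outer(2) by (simp add: k replicate_append_same)
      then have wp: "w = p @ [a] @ replicate j c"
        by simp
      let ?w = "p @ [c] @ replicate j a"
      have up: "?w @ [a, a] = p @ [c] @ replicate (Suc (Suc j)) a"
        by (simp add: replicate_app_Cons_same)
      have "?w \<in> W"
        using w[OF c] wp a c by (auto simp: W_def words_def)
      moreover have "f (?w @ [a, a]) = 2"
        using u(2) unfolding up outer(3) k .
      then have "a \<in> Z ?w"
        using a \<open>f (?w @ [a, a]) = 2\<close> by (simp add: Z_def)
      ultimately show ?thesis
        using wp up by (intro exI[of _ "(?w, a)"]) (simp, blast)
    qed
  qed
  then obtain h where h: "\<And>w. w \<in> Loss \<Longrightarrow> h w \<in> Sigma W Z"
      "\<And>w. w \<in> Loss \<Longrightarrow> \<exists>p k. w = p @ [snd (h w)] @ replicate k c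
         \<and> fst (h w) @ [snd (h w), snd (h w)] = p @ [c] @ replicate (Suc (Suc k)) (snd (h w))"
    by metis
  \<comment> \<open>The word named by \<open>h w\<close> determines \<open>p\<close>,
    \<open>k\<close> and \<open>a\<close>, hence \<open>w\<close>.\<close>
  have "inj_on h Loss"
  proof (rule inj_onI)
    fix v w assume vw: "v \<in> Loss" "w \<in> Loss" "h v = h w"
    define a where "a = snd (h w)"
    have "a \<noteq> c"
      using h(1)[OF vw(2)] by (auto simp: a_def Z_def)
    moreover obtain p k where "v = p @ [a] @ replicate k c"
        "fst (h w) @ [a, a] = p @ [c] @ replicate (Suc (Suc k)) a"
      using h(2)[OF vw(1)] unfolding vw(3) a_def by blast
    moreover obtain q l where "w = q @ [a] @ replicate l c"
        "fst (h w) @ [a, a] = q @ [c] @ replicate (Suc (Suc l)) a"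
      using h(2)[OF vw(2)] unfolding a_def by blast
    ultimately show "v = w"
      using append_replicate_eqD[of p c "Suc k" a q "Suc l" a] by auto
  qed
  moreover have "h ` Loss \<subseteq> Sigma W Z"
    using h(1) by blast
  moreover have "finite (Sigma W Z)"
    using finW fin by (auto simp: Z_def)
  ultimately have "card Loss \<le> card (Sigma W Z)"
    by (rule card_inj_on_le)
  also have "\<dots> = (\<Sum>w\<in>W. card (Z w))"
    using finW fin by (intro card_SigmaI) (auto simp: Z_def)
  finally have loss: "card Loss \<le> (\<Sum>w\<in>W. card (Z w))" .

  \<comment> \<open>Single blocks may fall short; only after summation over \<open>W\<close> do the
    gains cover the losses.\<close>
  have "(\<Sum>w\<in>W. 2 * order G - 1 + card (Z w))
      \<le> (\<Sum>w\<in>W. (\<Sum>z\<in>?V. \<Sum>x\<in>?V. f (w @ [z, x])) + (if w \<in> Loss then 1 else 0))"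
    by (intro sum_mono block)
  moreover have "(\<Sum>w\<in>W. if w \<in> Loss then 1 else 0) = card Loss"
    using finW by (simp add: sum.If_cases Loss_def Int_def)
  moreover have "card W = order G ^ m"
    using fin by (simp add: W_def card_words order_def)
  ultimately have "order G ^ m * (2 * order G - 1)
      \<le> (\<Sum>w\<in>W. \<Sum>z\<in>?V. \<Sum>x\<in>?V. f (w @ [z, x]))"
    using loss by (simp only: sum.distrib sum_constant of_nat_id)
  then show ?thesis
    by (simp add: weight_def sum_words_Suc_Suc W_def)
qed

theorem theorem8:
  fixes G :: "'a ugraph" and n t :: nat
  assumes "simple_graph G"
    and "order G = n"
    and "n \<ge> 4"
    and "\<exists>!v. v \<in> verts G \<and> degree G v = n - 1"
    and "t \<ge> 2"
  shows "roman_domination_number (sierpinski G t) = n ^ (t - 2) * (2 * n - 1)"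
proof -
  obtain m where t: "t = Suc (Suc m)"
    using \<open>t \<ge> 2\<close> by (metis add_2_eq_Suc le_Suc_ex)
  have ex1: "\<exists>!v. v \<in> verts G \<and> degree G v = order G - 1"
    using assms(2,4) by simp
  obtain c where c: "c \<in> verts G" "\<And>z. z \<in> verts G \<Longrightarrow> z \<noteq> c \<Longrightarrow> {c, z} \<in> edges G"
    "\<And>z. z \<in> verts G \<Longrightarrow> z \<noteq> c \<Longrightarrow> \<exists>x\<in>verts G. x \<noteq> z \<and> {x, z} \<notin> edges G"
    using ex1_universal_vertexE[OF assms(1) ex1] by blast
  show ?thesis
    unfolding roman_domination_number_def t \<open>order G = n\<close>[symmetric]
  proof (rule Least_equality)
    show "\<exists>f. roman_dominating (sierpinski G (Suc (Suc m))) f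
        \<and> weight (sierpinski G (Suc (Suc m))) f = order G ^ (Suc (Suc m) - 2) * (2 * order G - 1)"
      using roman_dominating_sierpinski_universal[OF assms(1) c(1,2), of m] by auto
  next
    fix k
    assume "\<exists>f. roman_dominating (sierpinski G (Suc (Suc m))) f
        \<and> weight (sierpinski G (Suc (Suc m))) f = k"
    then show "order G ^ (Suc (Suc m) - 2) * (2 * order G - 1) \<le> k"
      using weight_sierpinski_ge[OF assms(1) c, of m] by auto
  qed
qed

end
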